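(* Suppose that the initial battery level satisfies $E^0\in[E^{\min},E^{\max}]$ and that in every slot $k$ the PME's decision $(p_s^k,p_b^k,y^k)$ is an optimal solution of the per-slot problem described in the context. Let $\mathcal{C}^{\min}=\min\{C_bu^{\mathrm{cmax}},-C_bu^{\mathrm{dmax}}\}$, $\mathcal{C}^{\max}=\max\{C_bu^{\mathrm{cmax}},-C_bu^{\mathrm{dmax}}\}$ and $$\theta^{\min}=u^{\mathrm{cmax}}-E^{\max}-V_P\min_km_b^k-V_P\,\mathcal{C}^{\min},$$ $$\theta^{\max}=-u^{\mathrm{dmax}}-E^{\min}-V_P\max_km_s^k-V_P\,\mathcal{C}^{\max},$$ $$V_P^{\max}=\frac{E^{\max}-E^{\min}-(u^{\mathrm{cmax}}+u^{\mathrm{dmax}})}{\max_km_s^k-\min_km_b^k+\mathcal{C}^{\max}-\mathcal{C}^{\min}}.$$ If $\theta\in[\theta^{\min},\theta^{\max}]$ and $V_P\in(0,V_P^{\max}]$, then the battery energy level is guaranteed, i.e. $E^{\min}\le E^k\le E^{\max}$ for all $k$.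
   Context: All quantities are real; time slots are $k=0,1,2,\dots$. The public monitoring entity (PME) owns a battery with energy level $E^k$ evolving as $E^{k+1}=E^k+y^k$, where $y^k$ is the charged ($>0$) or discharged ($<0$) amount. $E^{\min},E^{\max}$ are the minimum and maximum allowable levels, $u^{\mathrm{cmax}},u^{\mathrm{dmax}}>0$ the maximum charging/discharging rates, $C_b>0$ the battery cost coefficient (cost $\tfrac12C_b(y^k)^2$ per slot), $V_P$ a weighting parameter, $\theta$ a constant shift parameter, and $B^k=E^k+\theta$ the virtual battery queue. $m_b^k<m_s^k$ are the buying and selling prices of the main grid, $G_T^k$ is the net generation of the PME, and $\max_k,\min_k$ denote maximum and minimum over time slots. In each slot $k$ the PME chooses $(p_s^k,p_b^k,y^k)$ (selling price, buying price, battery charge) to minimize $$pro'=B^ky^k-V_P\Big[\sum_{i=1}^n p_s^k\max(tp_i^k,0)+\sum_{i=1}^n p_b^k\min(tp_i^k,0)\Big]$$ $$\qquad+V_P\Big[m_s^k\max\Big(\sum_{i=1}^n tp_i^k-G_T^k+y^k,0\Big)+m_b^k\min\Big(\sum_{i=1}^n tp_i^k-G_T^k+y^k,0\Big)+\tfrac12C_b(y^k)^2\Big]$$ subject to $-u^{\mathrm{dmax}}\le y^k\le u^{\mathrm{cmax}}$, $m_b^k\le p_b^k<p_s^k\le m_s^k$, and $tp_i^k=D_i^k+e_i^{k,*}-RP_i^k$ for $i=1,\dots,n$. Here $D_i^k$ and $RP_i^k$ are the basic load and renewable generation of nanogrid $i$, and $e_i^{k,*}$ is the best response of nanogrid $i$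 to the prices, i.e. the minimizer of $$UN_i'(e)=V_i\gamma_i(1-\varepsilon_i)^2(\eta_ie)^2+\Big\{\varepsilon_i(1-\varepsilon_i)H_i^k+2V_i\gamma_i(1-\varepsilon_i)\big[(1-\varepsilon_i)T_{i,out}^k+\varepsilon_iT_i^k-T_i^{opt,k+1}\big]\Big\}\eta_ie$$ $$\qquad+V_i\Big[\tfrac12(p_s^k-p_b^k)|D_i^k-RP_i^k+e|+\tfrac12(p_s^k+p_b^k)(D_i^k-RP_i^k+e)\Big]$$ over $\max\{-L_i^{\max}-D_i^k+RP_i^k,0\}\le e\le\min\{L_i^{\max}-D_i^k+RP_i^k,e_i^{\max}\}$, where $\varepsilon_i\in(0,1)$, $\eta_i,\gamma_i,V_i>0$, $e_i^{\max},L_i^{\max}$ are constants of nanogrid $i$, $T_i^k,T_{i,out}^k,T_i^{opt,k+1}$ are its indoor, outdoor and optimum comfort temperatures, and $H_i^k=T_i^k+\Gamma_i$ with $\Gamma_i$ a constant. In particular $e_i^{k,*}$, hence $tp_i^k$, depends on the prices $p_s^k,p_b^k$ but not on $y^k$. *)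

theory Defs
  imports Complex_Main
begin

text \<open>
  Components of function type are sequences indexed by the time slot.
\<close>

record nanogrid =
  ng_eps :: real        (* \<epsilon>_i *)
  ng_eta :: real        (* \<eta>_i *)
  ng_gamma :: real      (* \<gamma>_i *)
  ng_V :: real          (* V_i *)
  ng_Gamma :: real      (* \<Gamma>_i, shift of the virtual temperature queue *)
  ng_emax :: real       (* maximal controllable load e_i^max *)
  ng_Lmax :: real       (* L_i^max, bound on the net load *)
  ng_D :: "nat \<Rightarrow> real"      (* basic load *)
  ng_RP :: "nat \<Rightarrow> real"     (* renewable generation *)
  ng_T :: "nat \<Rightarrow> real"      (* indoor temperature *)
  ng_Tout :: "nat \<Rightarrow> real"   (* outdoor temperature *)
  ng_Topt :: "nat \<Rightarrow> real"   (* optimum comfort temperature *)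

record pme =
  E_min :: real
  E_max :: real
  u_cmax :: real        (* maximal charging rate *)
  u_dmax :: real        (* maximal discharging rate *)
  C_b :: real           (* battery cost coefficient *)
  V_P :: real           (* weighting parameter *)
  shift :: real         (* \<theta> *)
  m_b :: "nat \<Rightarrow> real"  (* buying price of the main grid *)
  m_s :: "nat \<Rightarrow> real"  (* selling price of the main grid *)
  G_T :: "nat \<Rightarrow> real"  (* net generation of the PME *)

definition ng_H :: "nanogrid \<Rightarrow> nat \<Rightarrow> real" where
  "ng_H N k = ng_T N k + ng_Gamma N"

definition UN' :: "nanogrid \<Rightarrow> nat \<Rightarrow> real \<Rightarrow> real \<Rightarrow> real \<Rightarrow> real" where
  "UN' N k ps pb e =
     ng_V N * ng_gamma N * (1 - ng_eps N)\<^sup>2 * (ng_eta N * e)\<^sup>2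
     + (ng_eps N * (1 - ng_eps N) * ng_H N k
        + 2 * ng_V N * ng_gamma N * (1 - ng_eps N)
            * ((1 - ng_eps N) * ng_Tout N k + ng_eps N * ng_T N k - ng_Topt N (k + 1)))
       * ng_eta N * e
     + ng_V N * (1/2 * (ps - pb) * \<bar>ng_D N k - ng_RP N k + e\<bar>
                 + 1/2 * (ps + pb) * (ng_D N k - ng_RP N k + e))"

definition ng_feasible :: "nanogrid \<Rightarrow> nat \<Rightarrow> real set" where
  "ng_feasible N k =
     {max (- ng_Lmax N - ng_D N k + ng_RP N k) 0 ..
      min (ng_Lmax N - ng_D N k + ng_RP N k) (ng_emax N)}"

text \<open>
  The choice made by \<^const>\<open>arg_min_on\<close> is the unique minimizer whenever the feasible interval
  is nonempty and \<open>pb < ps\<close>; see \<open>best_response_unique_minimizer\<close> below.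
\<close>

definition best_response :: "nanogrid \<Rightarrow> nat \<Rightarrow> real \<Rightarrow> real \<Rightarrow> real" where
  "best_response N k ps pb = arg_min_on (UN' N k ps pb) (ng_feasible N k)"

definition tp :: "nanogrid \<Rightarrow> nat \<Rightarrow> real \<Rightarrow> real \<Rightarrow> real" where
  "tp N k ps pb = ng_D N k + best_response N k ps pb - ng_RP N k"

text \<open>In \<open>pro'\<close>, the argument \<open>B\<close> is the virtual battery queue in the slot \<open>k\<close>.\<close>

definition pro' ::
  "pme \<Rightarrow> (nat \<Rightarrow> nanogrid) \<Rightarrow> nat \<Rightarrow> nat \<Rightarrow> real \<Rightarrow> real \<times> real \<times> real \<Rightarrow> real" where
  "pro' M N n k B = (\<lambda>(ps, pb, y).
     B * y
     - V_P M * ((\<Sum>i=1..n. ps * max (tp (N i) k ps pb) 0)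
                + (\<Sum>i=1..n. pb * min (tp (N i) k ps pb) 0))
     + V_P M * (m_s M k * max ((\<Sum>i=1..n. tp (N i) k ps pb) - G_T M k + y) 0
                + m_b M k * min ((\<Sum>i=1..n. tp (N i) k ps pb) - G_T M k + y) 0
                + 1/2 * C_b M * y\<^sup>2))"

definition pme_feasible :: "pme \<Rightarrow> nat \<Rightarrow> (real \<times> real \<times> real) set" where
  "pme_feasible M k =
     {(ps, pb, y). - u_dmax M \<le> y \<and> y \<le> u_cmax M
                   \<and> m_b M k \<le> pb \<and> pb < ps \<and> ps \<le> m_s M k}"

definition pme_optimal ::
  "pme \<Rightarrow> (nat \<Rightarrow> nanogrid) \<Rightarrow> nat \<Rightarrow> nat \<Rightarrow> real \<Rightarrow> real \<times> real \<times> real \<Rightarrow> bool" where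
  "pme_optimal M N n k B d \<longleftrightarrow>
     is_arg_min (pro' M N n k B) (\<lambda>d. d \<in> pme_feasible M k) d"

definition cost_min :: "pme \<Rightarrow> real" where
  "cost_min M = min (C_b M * u_cmax M) (- C_b M * u_dmax M)"

definition cost_max :: "pme \<Rightarrow> real" where
  "cost_max M = max (C_b M * u_cmax M) (- C_b M * u_dmax M)"

text \<open>
  The extreme prices over the infinitely many slots are taken as infimum and supremum, which
  coincide with minimum and maximum when these are attained. They are meaningful only for
  prices that are bounded below and above, respectively.
\<close>

definition theta_min :: "pme \<Rightarrow> real" where
  "theta_min M = u_cmax M - E_max M - V_P M * (INF k. m_b M k) - V_P M * cost_min M"

definition theta_max :: "pme \<Rightarrow> real" where
  "theta_max M = - u_dmax M - E_min M - V_P M * (SUP k. m_s M k) - V_P M * cost_max M"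

definition V_P_max :: "pme \<Rightarrow> real" where
  "V_P_max M = (E_max M - E_min M - (u_cmax M + u_dmax M))
     / ((SUP k. m_s M k) - (INF k. m_b M k) + cost_max M - cost_min M)"

lemma UN'_midpoint_less:
  assumes "ng_eps N < 1" "ng_eta N > 0" "ng_gamma N > 0" "ng_V N > 0" "pb < ps" "a \<noteq> b"
  shows "UN' N k ps pb ((a + b) / 2) < (UN' N k ps pb a + UN' N k ps pb b) / 2"
proof -
  define q where "q = ng_V N * ng_gamma N * (1 - ng_eps N)\<^sup>2 * (ng_eta N)\<^sup>2"
  define c where "c = (ng_eps N * (1 - ng_eps N) * ng_H N k
        + 2 * ng_V N * ng_gamma N * (1 - ng_eps N)
            * ((1 - ng_eps N) * ng_Tout N k + ng_eps N * ng_T N k - ng_Topt N (k + 1)))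
       * ng_eta N"
  define d where "d = ng_D N k - ng_RP N k"
  define v where "v = ng_V N * (1/2 * (ps - pb))"
  define w where "w = ng_V N * (1/2 * (ps + pb))"
  have eq: "UN' N k ps pb e = q * e\<^sup>2 + c * e + v * \<bar>d + e\<bar> + w * (d + e)" for e
    unfolding UN'_def q_def c_def d_def v_def w_def
    by (simp add: power_mult_distrib field_simps)
  have q: "q > 0" and v: "v > 0"
    using assms by (simp_all add: q_def v_def)
  have "q * (a - b)\<^sup>2 > 0"
    using q assms(6) by simp
  then have 1: "q * ((a + b) / 2)\<^sup>2 < (q * a\<^sup>2 + q * b\<^sup>2) / 2"
    by (simp add: power2_eq_square algebra_simps)
  have "\<bar>d + (a + b) / 2\<bar> \<le> (\<bar>d + a\<bar> + \<bar>d + b\<bar>) / 2"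
    by (simp add: abs_if field_simps)
  from mult_left_mono[OF this, of v] v
  have 2: "v * \<bar>d + (a + b) / 2\<bar> \<le> (v * \<bar>d + a\<bar> + v * \<bar>d + b\<bar>) / 2"
    by (simp add: algebra_simps)
  from 1 2 show ?thesis
    unfolding eq by (simp add: field_simps)
qed

lemma best_response_unique_minimizer:
  assumes "ng_eps N < 1" "ng_eta N > 0" "ng_gamma N > 0" "ng_V N > 0" "pb < ps"
    and "ng_feasible N k \<noteq> {}"
  shows "is_arg_min (UN' N k ps pb) (\<lambda>e. e \<in> ng_feasible N k) e
           \<longleftrightarrow> e = best_response N k ps pb"
proof -
  let ?f = "UN' N k ps pb" and ?P = "\<lambda>e. e \<in> ng_feasible N k"
  have uniq: "a = b" if "is_arg_min ?f ?P a" "is_arg_min ?f ?P b" for a b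
  proof (rule ccontr)
    assume "a \<noteq> b"
    with UN'_midpoint_less[OF assms(1-5)]
    have "?f ((a + b) / 2) < (?f a + ?f b) / 2" by blast
    moreover have "?P ((a + b) / 2)"
      using that by (simp add: is_arg_min_linorder ng_feasible_def max_def min_def split: if_splits)
    ultimately show False
      using that by (fastforce simp: is_arg_min_linorder)
  qed
  have "continuous_on (ng_feasible N k) ?f"
    unfolding UN'_def by (intro continuous_intros)
  moreover have "compact (ng_feasible N k)"
    unfolding ng_feasible_def by (rule compact_Icc)
  ultimately obtain a where "is_arg_min ?f ?P a"
    using continuous_attains_inf[of "ng_feasible N k" ?f] assms(6)
    by (auto simp: is_arg_min_linorder)
  moreover from this have "is_arg_min ?f ?P (best_response N k ps pb)"
    unfolding best_response_def arg_min_on_def arg_min_def by (rule someI)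
  ultimately show ?thesis
    using uniq by blast
qed

end

theory Submission
  imports Defs
begin

text \<open>
  For fixed prices the objective is convex in the battery action \<open>y\<close>, with slopes between
  \<open>B + V_P (m_b + C_b y)\<close> and \<open>B + V_P (m_s + C_b y)\<close>. If the level exceeds \<open>E_max - u_cmax\<close>,
  the lower bound on the shift makes every slope positive, so the optimal action is full
  discharge; if it is below \<open>E_min + u_dmax\<close>, the upper bound on the shift makes every slope
  negative, so the optimal action is full charge. The bound on the weight gives
  \<open>u_cmax + u_dmax \<le> E_max - E_min\<close>, so neither extreme action overshoots the opposite limit.
\<close>

text \<open>Moving from \<open>s\<close> to \<open>t\<close> splits \<open>t - s\<close> into
  nonnegative parts: \<open>p\<close> above zero, priced at \<open>ms\<close>, and \<open>q\<close>
  below zero, priced at \<open>mb\<close>. The increment \<open>ms * p + mb * q\<close> is thus a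
  weighted mix of the two prices.\<close>

lemma grid_cost_increment_bounds:
  fixes mb ms a s t :: real
  assumes "mb \<le> ms" "s \<le> t"
  defines "g \<equiv> \<lambda>y. ms * max (a + y) 0 + mb * min (a + y) 0"
  shows "mb * (t - s) \<le> g t - g s" and "g t - g s \<le> ms * (t - s)"
proof -
  define p where "p = max (a + t) 0 - max (a + s) 0"
  define q where "q = min (a + t) 0 - min (a + s) 0"
  have pq: "0 \<le> p" "0 \<le> q" "t - s = p + q"
    using assms(2) by (auto simp: p_def q_def max_def min_def)
  have g: "g t - g s = ms * p + mb * q"
    by (simp add: g_def p_def q_def algebra_simps)
  show "mb * (t - s) \<le> g t - g s" "g t - g s \<le> ms * (t - s)"
    using mult_right_mono[OF assms(1) pq(1)] mult_right_mono[OF assms(1) pq(2)]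
    by (simp_all add: g pq(3) algebra_simps)
qed

text \<open>With prices fixed, every \<open>tp\<close> is constant in the battery action, so the
  trading revenue cancels. The battery slope is evaluated at \<open>s\<close> below and at
  \<open>t\<close> above, so that comparison with an extreme action gives a bound involving only the
  rate limit.\<close>

lemma pro'_increment_bounds:
  assumes "m_b M k \<le> m_s M k" "0 \<le> V_P M" "0 \<le> C_b M" "s \<le> t"
  shows "(t - s) * (B + V_P M * (m_b M k + C_b M * s))
           \<le> pro' M N n k B (ps, pb, t) - pro' M N n k B (ps, pb, s)" (is ?lower)
    and "pro' M N n k B (ps, pb, t) - pro' M N n k B (ps, pb, s)
           \<le> (t - s) * (B + V_P M * (m_s M k + C_b M * t))" (is ?upper)
proof -
  define a where "a = (\<Sum>i=1..n. tp (N i) k ps pb) - G_T M k"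
  define g where "g = (\<lambda>y. m_s M k * max (a + y) 0 + m_b M k * min (a + y) 0)"
  have diff: "pro' M N n k B (ps, pb, t) - pro' M N n k B (ps, pb, s)
      = B * (t - s) + V_P M * ((g t - g s) + C_b M * ((t\<^sup>2 - s\<^sup>2) / 2))"
    by (simp add: pro'_def g_def a_def algebra_simps diff_divide_distrib)
  have grid: "m_b M k * (t - s) \<le> g t - g s" "g t - g s \<le> m_s M k * (t - s)"
    unfolding g_def by (fact grid_cost_increment_bounds[OF assms(1,4)])+
  \<comment> \<open>Both tangent estimates of the quadratic err by the same square.\<close>
  have "(t\<^sup>2 - s\<^sup>2) / 2 - s * (t - s) = (t - s)\<^sup>2 / 2" "t * (t - s) - (t\<^sup>2 - s\<^sup>2) / 2 = (t - s)\<^sup>2 / 2"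
    by (simp_all add: power2_eq_square field_simps)
  then have "s * (t - s) \<le> (t\<^sup>2 - s\<^sup>2) / 2" "(t\<^sup>2 - s\<^sup>2) / 2 \<le> t * (t - s)"
    by (smt (verit) zero_le_power2 divide_nonneg_pos)+
  then have battery: "C_b M * (s * (t - s)) \<le> C_b M * ((t\<^sup>2 - s\<^sup>2) / 2)"
      "C_b M * ((t\<^sup>2 - s\<^sup>2) / 2) \<le> C_b M * (t * (t - s))"
    using assms(3) by (simp_all only: mult_left_mono)
  show ?lower
    using mult_left_mono[OF add_mono[OF grid(1) battery(1)] assms(2)]
    by (simp add: diff algebra_simps)
  show ?upper
    using mult_left_mono[OF add_mono[OF grid(2) battery(2)] assms(2)]
    by (simp add: diff algebra_simps)
qed

text \<open>Keeping the prices and replacing \<open>y\<close> by \<open>- u_dmax M\<close> stays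
  feasible. By convexity the smallest slope is at that endpoint; if it is positive there, any larger
  \<open>y\<close> costs strictly more.\<close>

lemma pme_optimal_full_discharge:
  assumes "pme_optimal M N n k B (ps, pb, y)"
    and "0 \<le> V_P M" "0 \<le> C_b M"
    and "0 < B + V_P M * (m_b M k - C_b M * u_dmax M)"
  shows "y = - u_dmax M"
proof (rule ccontr)
  assume "y \<noteq> - u_dmax M"
  moreover have "(ps, pb, y) \<in> pme_feasible M k"
    and opt: "d \<in> pme_feasible M k \<Longrightarrow> pro' M N n k B (ps, pb, y) \<le> pro' M N n k B d" for d
    using assms(1) by (auto simp: pme_optimal_def is_arg_min_linorder simp del: split_paired_All)
  ultimately have y: "- u_dmax M < y" and price: "m_b M k \<le> m_s M k"
    and "(ps, pb, - u_dmax M) \<in> pme_feasible M k"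
    by (auto simp: pme_feasible_def)
  with opt have "pro' M N n k B (ps, pb, y) \<le> pro' M N n k B (ps, pb, - u_dmax M)"
    by blast
  moreover have "0 < (y - - u_dmax M) * (B + V_P M * (m_b M k + C_b M * - u_dmax M))"
    using y assms(4) by simp
  ultimately show False
    using pro'_increment_bounds(1)[OF price assms(2,3) less_imp_le[OF y], of B N n ps pb] by linarith
qed

text \<open>Mirror image: the largest slope is at \<open>u_cmax M\<close>, and if it is negative
  there, raising \<open>y\<close> to that value strictly lowers the cost.\<close>

lemma pme_optimal_full_charge:
  assumes "pme_optimal M N n k B (ps, pb, y)"
    and "0 \<le> V_P M" "0 \<le> C_b M"
    and "B + V_P M * (m_s M k + C_b M * u_cmax M) < 0"
  shows "y = u_cmax M"
proof (rule ccontr)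
  assume "y \<noteq> u_cmax M"
  moreover have "(ps, pb, y) \<in> pme_feasible M k"
    and opt: "d \<in> pme_feasible M k \<Longrightarrow> pro' M N n k B (ps, pb, y) \<le> pro' M N n k B d" for d
    using assms(1) by (auto simp: pme_optimal_def is_arg_min_linorder simp del: split_paired_All)
  ultimately have y: "y < u_cmax M" and price: "m_b M k \<le> m_s M k"
    and "(ps, pb, u_cmax M) \<in> pme_feasible M k"
    by (auto simp: pme_feasible_def)
  with opt have "pro' M N n k B (ps, pb, y) \<le> pro' M N n k B (ps, pb, u_cmax M)"
    by blast
  moreover have "(u_cmax M - y) * (B + V_P M * (m_s M k + C_b M * u_cmax M)) < 0"
    using y assms(4) by (intro mult_pos_neg) simp_all
  ultimately show False
    using pro'_increment_bounds(2)[OF price assms(2,3) less_imp_le[OF y], of N n B ps pb] by linarith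
qed

theorem theorem4:
  fixes M :: pme and N :: "nat \<Rightarrow> nanogrid" and n :: nat
    and E ps pb y :: "nat \<Rightarrow> real"
  assumes nanogrid_params: "\<And>i. i \<in> {1..n} \<Longrightarrow>
      0 < ng_eps (N i) \<and> ng_eps (N i) < 1 \<and> 0 < ng_eta (N i) \<and> 0 < ng_gamma (N i) \<and> 0 < ng_V (N i)"
    and nanogrid_feasible: "\<And>i k. i \<in> {1..n} \<Longrightarrow> ng_feasible (N i) k \<noteq> {}"
    and pme_params: "0 < u_cmax M" "0 < u_dmax M" "0 < C_b M"
    and prices: "\<And>k. m_b M k < m_s M k"
    and prices_bounded: "bdd_below (range (m_b M))" "bdd_above (range (m_s M))"
    and battery: "\<And>k. E (Suc k) = E k + y k"
    and initial: "E 0 \<in> {E_min M..E_max M}"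
    and optimal: "\<And>k. pme_optimal M N n k (E k + shift M) (ps k, pb k, y k)"
    and theta: "shift M \<in> {theta_min M..theta_max M}"
    and weight: "V_P M \<in> {0<..V_P_max M}"
  shows "\<forall>k. E_min M \<le> E k \<and> E k \<le> E_max M"
proof
  have V: "0 < V_P M" and V_le: "V_P M \<le> V_P_max M"
    using weight by auto
  have inf_le: "(INF k. m_b M k) \<le> m_b M k" for k
    by (rule cINF_lower[OF prices_bounded(1)]) simp
  have le_sup: "m_s M k \<le> (SUP k. m_s M k)" for k
    by (rule cSUP_upper[OF _ prices_bounded(2)]) simp
  have "0 < C_b M * u_cmax M" "0 < C_b M * u_dmax M"
    using pme_params by simp_all
  then have cost: "cost_min M = - (C_b M * u_dmax M)" "cost_max M = C_b M * u_cmax M"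
    and cost_pos: "0 < cost_max M - cost_min M"
    by (simp_all add: cost_min_def cost_max_def)
  have "0 < (SUP k. m_s M k) - (INF k. m_b M k) + cost_max M - cost_min M"
    using cost_pos inf_le[of 0] le_sup[of 0] prices[of 0] by linarith
  \<comment> \<open>A positive quotient with positive denominator has a positive numerator.\<close>
  moreover have "0 < V_P_max M"
    using V V_le by linarith
  ultimately have room: "u_cmax M + u_dmax M < E_max M - E_min M"
    by (simp add: V_P_max_def zero_less_divide_iff)
  fix k
  show "E_min M \<le> E k \<and> E k \<le> E_max M"
  proof (induction k)
    case 0
    then show ?case
      using initial by simp
  next
    case (Suc k)
    have rate: "- u_dmax M \<le> y k" "y k \<le> u_cmax M"
      using optimal[of k] by (auto simp: pme_optimal_def is_arg_min_linorder pme_feasible_def)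
    \<comment> \<open>The thresholds mark where some admissible action could leave the interval;
      between them every admissible action is safe.\<close>
    consider "E_max M - u_cmax M < E k" | "E k < E_min M + u_dmax M"
      | "E k \<le> E_max M - u_cmax M" "E_min M + u_dmax M \<le> E k"
      by linarith
    then show ?case
    proof cases
      case 1
      \<comment> \<open>At \<open>shift M = theta_min M\<close> the right-hand side is exactly
        \<open>E k - (E_max M - u_cmax M)\<close>.\<close>
      have "0 < E k + shift M + V_P M * ((INF k. m_b M k) - C_b M * u_dmax M)"
        using 1 theta by (simp add: theta_min_def cost algebra_simps)
      also have "\<dots> \<le> E k + shift M + V_P M * (m_b M k - C_b M * u_dmax M)"
        using V inf_le[of k] by simp
      finally have "y k = - u_dmax M"
        using pme_optimal_full_discharge[OF optimal] V pme_params by simp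
      \<comment> \<open>Discharging keeps the level below \<open>E_max M\<close>; by
        \<open>room\<close> it still ends above \<open>E_min M\<close>.\<close>
      then show ?thesis
        using 1 Suc.IH room pme_params battery[of k] by simp
    next
      case 2
      have "E k + shift M + V_P M * (m_s M k + C_b M * u_cmax M)
          \<le> E k + shift M + V_P M * ((SUP k. m_s M k) + C_b M * u_cmax M)"
        using V le_sup[of k] by simp
      \<comment> \<open>At \<open>shift M = theta_max M\<close> the left-hand side is exactly
        \<open>E k - (E_min M + u_dmax M)\<close>.\<close>
      also have "\<dots> < 0"
        using 2 theta by (simp add: theta_max_def cost algebra_simps)
      finally have "y k = u_cmax M"
        using pme_optimal_full_charge[OF optimal] V pme_params by simp
      then show ?thesis
        using 2 Suc.IH room pme_params battery[of k] by simp
    next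
      case 3
      then show ?thesis
        using rate battery[of k] by simp
    qed
  qed
qed

end
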